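(* Let $n\in\mathbb{N}$, let $\alpha>0$ be a real number and let $\lambda\in(0,1)$. Let $X_1,\dots,X_n$ be independent Bernoulli random variables with $P\{X_j=1\}=\frac{1}{j}$ and $P\{X_j=0\}=1-\frac{1}{j}$ for $j=1,\dots,n$, and put $Y_n=X_1+\cdots+X_n$. Let $X_{1,\lambda}(\alpha),\dots,X_{n,\lambda}(\alpha)$ be independent Bernoulli random variables with $P\{X_{j,\lambda}(\alpha)=1\}=\frac{\alpha}{\alpha+\lambda j}$ and $P\{X_{j,\lambda}(\alpha)=0\}=1-\frac{\alpha}{\alpha+\lambda j}$ for $j=1,\dots,n$, and put $Z_{n,\lambda}(\alpha)=X_{1,\lambda}(\alpha)+\cdots+X_{n,\lambda}(\alpha)$. Then for every (complex) number $z$, $$E\Big[\Big(1+\frac{\alpha}{\lambda}\Big)^{Y_n}\Big]\,E\Big[z^{Z_{n,\lambda}(\alpha)}\Big]=E\Big[\Big(1+\frac{\alpha z}{\lambda}\Big)^{Y_n}\Big].$$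
   Context: Here $E$ denotes expectation; $Y_n$ and $Z_{n,\lambda}(\alpha)$ take integer values in $\{0,1,\dots,n\}$, so all expectations are finite sums. *)

theory Defs
  imports "HOL-Probability.Probability"
begin

end

theory Submission
  imports Defs
begin

text \<open>The probability generating function of a sum of independent Bernoulli variables factors:
  E[w^S] is the product of 1 + p_j (w - 1) (\<open>expectation_power_sum_indep_bernoulli\<close>).
  All three expectations thus become products over the same index set, and the claim reduces to one
  identity per index j: (lam j + \<alpha>)/(lam j) times (lam j + \<alpha> z)/(\<alpha> + lam j)
  equals 1 + \<alpha> z/(lam j). The success probability of \<open>XL j\<close> has exactly the
  denominator that cancels the numerator coming from \<open>X j\<close> at w = 1 +
  \<alpha>/lam.\<close>

text \<open>The hypotheses fix only the masses at 0 and 1, so other values may occur on a null set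
  and the equation can hold only almost everywhere. The right-hand side is affine in an indicator,
  so its integrability and integral are immediate.\<close>

lemma (in prob_space) bernoulli_power_eq_AE:
  fixes Y :: "'a \<Rightarrow> nat" and w :: "'b::{real_normed_field,banach,second_countable_topology}"
  assumes meas: "Y \<in> measurable M (count_space UNIV)"
    and p1: "\<P>(\<omega> in M. Y \<omega> = 1) = p" and p0: "\<P>(\<omega> in M. Y \<omega> = 0) = 1 - p"
  shows "AE \<omega> in M. w ^ Y \<omega> = 1 + indicator {\<omega>\<in>space M. Y \<omega> = 1} \<omega> *\<^sub>R (w - 1)"
proof -
  note [measurable] = meas
  have "\<P>(\<omega> in M. Y \<omega> = 1 \<or> Y \<omega> = 0) = prob ({\<omega>\<in>space M. Y \<omega> = 1} \<union> {\<omega>\<in>space M. Y \<omega> = 0})"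
    by (rule arg_cong[where f = prob]) auto
  also have "\<dots> = 1"
    \<comment> \<open>The two events are disjoint, and p + (1 - p) = 1.\<close>
    by (subst finite_measure_Union) (auto simp: p1 p0 simp del: One_nat_def)
  finally have "AE \<omega> in M. Y \<omega> = 1 \<or> Y \<omega> = 0"
    by (intro AE_I_eq_1) (auto simp: emeasure_eq_measure)
  then show ?thesis
    using AE_space by eventually_elim auto
qed

lemma (in prob_space)
  fixes Y :: "'a \<Rightarrow> nat" and w :: "'b::{real_normed_field,banach,second_countable_topology}"
  assumes meas: "Y \<in> measurable M (count_space UNIV)"
    and p1: "\<P>(\<omega> in M. Y \<omega> = 1) = p" and p0: "\<P>(\<omega> in M. Y \<omega> = 0) = 1 - p"
  shows integrable_bernoulli_power: "integrable M (\<lambda>\<omega>. w ^ Y \<omega>)"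
    and expectation_bernoulli_power: "(\<integral>\<omega>. w ^ Y \<omega> \<partial>M) = 1 + of_real p * (w - 1)"
proof -
  note [measurable] = meas
  note eq = bernoulli_power_eq_AE[OF assms, of w]
  let ?A = "{\<omega>\<in>space M. Y \<omega> = 1}"
  have int: "integrable M (\<lambda>\<omega>. indicator ?A \<omega> *\<^sub>R (w - 1))"
    by (intro integrable_scaleR_left integrable_real_indicator) (auto simp: less_top[symmetric])
  have pow: "(\<lambda>\<omega>. w ^ Y \<omega>) \<in> borel_measurable M"
    using measurable_compose[OF meas, of "\<lambda>k. w ^ k" borel] by simp
  show "integrable M (\<lambda>\<omega>. w ^ Y \<omega>)"
    by (subst integrable_cong_AE[OF _ _ eq]) (use int pow in auto)
  have "(\<integral>\<omega>. w ^ Y \<omega> \<partial>M) = (\<integral>\<omega>. 1 + indicator ?A \<omega> *\<^sub>R (w - 1) \<partial>M)"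
    by (intro integral_cong_AE eq pow) auto
  also have "\<dots> = 1 + prob ?A *\<^sub>R (w - 1)"
    by (subst Bochner_Integration.integral_add[OF _ int]) (auto simp: prob_space less_top[symmetric])
  also have "\<dots> = 1 + of_real p * (w - 1)"
    unfolding p1 by (simp add: scaleR_conv_of_real)
  finally show "(\<integral>\<omega>. w ^ Y \<omega> \<partial>M) = 1 + of_real p * (w - 1)" .
qed

text \<open>The power of a sum is a product of powers of independent variables, so its expectation
  factors. Keeping the field \<open>'b\<close> general lets the same lemma serve the real base 1 +
  \<alpha>/lam and the complex bases.\<close>

lemma (in prob_space) expectation_power_sum_indep_bernoulli:
  fixes Y :: "'i \<Rightarrow> 'a \<Rightarrow> nat" and w :: "'b::{real_normed_field,banach,second_countable_topology}"
  assumes "finite I" and indep: "indep_vars (\<lambda>_. count_space UNIV) Y I"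
    and p1: "\<And>i. i \<in> I \<Longrightarrow> \<P>(\<omega> in M. Y i \<omega> = 1) = p i"
    and p0: "\<And>i. i \<in> I \<Longrightarrow> \<P>(\<omega> in M. Y i \<omega> = 0) = 1 - p i"
  shows "(\<integral>\<omega>. w ^ (\<Sum>i\<in>I. Y i \<omega>) \<partial>M) = (\<Prod>i\<in>I. 1 + of_real (p i) * (w - 1))"
proof -
  have meas: "Y i \<in> measurable M (count_space UNIV)" if "i \<in> I" for i
    using indep that by (auto simp: indep_vars_def)
  have "indep_vars (\<lambda>_. borel) (\<lambda>i \<omega>. w ^ Y i \<omega>) I"
    using indep_vars_compose2[OF indep, of "\<lambda>_ k. w ^ k" "\<lambda>_. borel"] by simp
  then have "(\<integral>\<omega>. (\<Prod>i\<in>I. w ^ Y i \<omega>) \<partial>M) = (\<Prod>i\<in>I. \<integral>\<omega>. w ^ Y i \<omega> \<partial>M)"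
    using \<open>finite I\<close> integrable_bernoulli_power[OF meas p1 p0]
    by (intro indep_vars_lebesgue_integral) auto
  also have "\<dots> = (\<Prod>i\<in>I. 1 + of_real (p i) * (w - 1))"
    by (intro prod.cong refl expectation_bernoulli_power meas p1 p0)
  finally show ?thesis
    by (simp add: power_sum)
qed

theorem theorem2:
  fixes M :: "'a measure" and X XL :: "nat \<Rightarrow> 'a \<Rightarrow> nat"
    and n :: nat and \<alpha> lam :: real and z :: complex
  assumes "prob_space M"
    and "\<alpha> > 0" and "0 < lam" and "lam < 1"
    and "prob_space.indep_vars M (\<lambda>_. count_space UNIV) X {1..n}"
    and "\<And>j. j \<in> {1..n} \<Longrightarrow> \<P>(\<omega> in M. X j \<omega> = 1) = 1 / real j"
    and "\<And>j. j \<in> {1..n} \<Longrightarrow> \<P>(\<omega> in M. X j \<omega> = 0) = 1 - 1 / real j"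
    and "prob_space.indep_vars M (\<lambda>_. count_space UNIV) XL {1..n}"
    and "\<And>j. j \<in> {1..n} \<Longrightarrow> \<P>(\<omega> in M. XL j \<omega> = 1) = \<alpha> / (\<alpha> + lam * real j)"
    and "\<And>j. j \<in> {1..n} \<Longrightarrow> \<P>(\<omega> in M. XL j \<omega> = 0) = 1 - \<alpha> / (\<alpha> + lam * real j)"
  shows "complex_of_real (\<integral>\<omega>. (1 + \<alpha> / lam) ^ (\<Sum>j=1..n. X j \<omega>) \<partial>M)
           * (\<integral>\<omega>. z ^ (\<Sum>j=1..n. XL j \<omega>) \<partial>M)
         = (\<integral>\<omega>. (1 + complex_of_real \<alpha> * z / complex_of_real lam) ^ (\<Sum>j=1..n. X j \<omega>) \<partial>M)"
proof -
  interpret prob_space M by fact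
  let ?w = "1 + complex_of_real \<alpha> * z / complex_of_real lam"
  \<comment> \<open>The identity for a single index; the common factor \<alpha> + lam j
    cancels.\<close>
  have "complex_of_real (1 + 1 / real j * (1 + \<alpha> / lam - 1))
          * (1 + complex_of_real (\<alpha> / (\<alpha> + lam * real j)) * (z - 1))
        = 1 + complex_of_real (1 / real j) * (?w - 1)" if "j \<in> {1..n}" for j
  proof -
    \<comment> \<open>Indices start at 1, so j is nonzero and every denominator is
      invertible.\<close>
    have "lam * real j > 0"
      using that assms by simp
    then have "complex_of_real (\<alpha> + lam * real j) \<noteq> 0"
      using assms by (simp only: of_real_eq_0_iff)
    moreover have "complex_of_real lam \<noteq> 0" "of_nat j \<noteq> (0::complex)"
      using that assms by auto
    ultimately show ?thesis
      by (simp add: divide_simps) (simp add: algebra_simps)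
  qed
  then have "(\<Prod>j=1..n. complex_of_real (1 + 1 / real j * (1 + \<alpha> / lam - 1)))
       * (\<Prod>j=1..n. 1 + complex_of_real (\<alpha> / (\<alpha> + lam * real j)) * (z - 1))
     = (\<Prod>j=1..n. 1 + complex_of_real (1 / real j) * (?w - 1))"
    unfolding prod.distrib[symmetric] by (intro prod.cong refl)
  moreover have "(\<integral>\<omega>. (1 + \<alpha> / lam) ^ (\<Sum>j=1..n. X j \<omega>) \<partial>M)
      = (\<Prod>j=1..n. 1 + of_real (1 / real j) * ((1 + \<alpha> / lam) - 1))"
    using assms by (intro expectation_power_sum_indep_bernoulli) auto
  moreover have "(\<integral>\<omega>. ?w ^ (\<Sum>j=1..n. X j \<omega>) \<partial>M)
      = (\<Prod>j=1..n. 1 + of_real (1 / real j) * (?w - 1))"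
    using assms by (intro expectation_power_sum_indep_bernoulli) auto
  moreover have "(\<integral>\<omega>. z ^ (\<Sum>j=1..n. XL j \<omega>) \<partial>M)
      = (\<Prod>j=1..n. 1 + of_real (\<alpha> / (\<alpha> + lam * real j)) * (z - 1))"
    using assms by (intro expectation_power_sum_indep_bernoulli) auto
  ultimately show ?thesis
    \<comment> \<open>In the real instance \<open>of_real\<close> is the identity on the reals; once
      it is removed, \<open>of_real_prod\<close> moves the outer embedding into the product, which
      then matches the termwise identity.\<close>
    by (simp only: of_real_prod id_apply of_real_eq_id)
qed

end
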